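(* Let $d>1$ be an integer and, for $t\in\mathbb{C}$, let $f_t\colon(\mathbb{C}^2,0)\to(\mathbb{C},0)$ be the polynomial function-germ $$f_t(x,y)=x^3-3t^2xy^{2d}+y^{3d}.$$ Then there exists an uncountable subset $I\subset\mathbb{C}$ such that $f_t$ is not Hölder equivalent to $f_s$ for any $s,t\in I$ with $t\neq s$.
   Context: For $\alpha\in(0,1]$, a map $h\colon X\to Y$ between subsets of Euclidean spaces is $\alpha$-Hölder if there is $\lambda>0$ with $|h(x_1)-h(x_2)|\le\lambda|x_1-x_2|^{\alpha}$ for all $x_1,x_2\in X$; it is bi-$\alpha$-Hölder if it is a homeomorphism and both $h$ and $h^{-1}$ are $\alpha$-Hölder. Two function-germs $f,g\colon(\mathbb{C}^2,0)\to(\mathbb{C},0)$ (with $\mathbb{C}^2\cong\mathbb{R}^4$) are bi-$\alpha$-Hölder conjugated if there is a germ of bi-$\alpha$-Hölder homeomorphism $H\colon(\mathbb{C}^2,0)\to(\mathbb{C}^2,0)$ with $f=g\circ H$. They are Hölder equivalent if they are bi-$\alpha$-Hölder conjugated for every $\alpha\in(0,1)$ (the homeomorphism may depend on $\alpha$). *)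

theory Defs
  imports "HOL-Analysis.Analysis"
begin

definition holder_map ::
    "real \<Rightarrow> 'a::euclidean_space set \<Rightarrow> ('a \<Rightarrow> 'b::euclidean_space) \<Rightarrow> bool" where
  "holder_map \<alpha> X h \<longleftrightarrow>
     (\<exists>c>0. \<forall>x1\<in>X. \<forall>x2\<in>X. norm (h x1 - h x2) \<le> c * norm (x1 - x2) powr \<alpha>)"

definition bi_holder ::
    "real \<Rightarrow> 'a::euclidean_space set \<Rightarrow> 'b::euclidean_space set \<Rightarrow> ('a \<Rightarrow> 'b) \<Rightarrow> bool" where
  "bi_holder \<alpha> X Y h \<longleftrightarrow>
     (\<exists>h'. homeomorphism X Y h h' \<and> holder_map \<alpha> X h \<and> holder_map \<alpha> Y h')"

text \<open>
  The complex plane squared is the type \<^typ>\<open>complex \<times> complex\<close>; its norm is the Euclidean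
  norm of real 4-space. Germs at 0 are given by representatives, which matter only near 0: the map
  below represents the germ of a homeomorphism between open neighbourhoods of 0, and germs agree
  when their representatives agree on some neighbourhood of 0.
\<close>

definition bi_holder_germ :: "real \<Rightarrow> (complex \<times> complex \<Rightarrow> complex \<times> complex) \<Rightarrow> bool" where
  "bi_holder_germ \<alpha> H \<longleftrightarrow>
     H 0 = 0 \<and> (\<exists>U V. open U \<and> 0 \<in> U \<and> open V \<and> 0 \<in> V \<and> bi_holder \<alpha> U V H)"

definition bi_holder_conjugated ::
    "real \<Rightarrow> (complex \<times> complex \<Rightarrow> complex) \<Rightarrow> (complex \<times> complex \<Rightarrow> complex) \<Rightarrow> bool" where
  "bi_holder_conjugated \<alpha> f g \<longleftrightarrow>
     (\<exists>H. bi_holder_germ \<alpha> H \<and> (\<forall>\<^sub>F z in nhds 0. f z = (g \<circ> H) z))"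

definition holder_equivalent ::
    "(complex \<times> complex \<Rightarrow> complex) \<Rightarrow> (complex \<times> complex \<Rightarrow> complex) \<Rightarrow> bool" where
  "holder_equivalent f g \<longleftrightarrow> (\<forall>\<alpha>. 0 < \<alpha> \<and> \<alpha> < 1 \<longrightarrow> bi_holder_conjugated \<alpha> f g)"

definition f_germ :: "nat \<Rightarrow> complex \<Rightarrow> complex \<times> complex \<Rightarrow> complex" where
  "f_germ d t = (\<lambda>(x, y). x ^ 3 - 3 * t ^ 2 * x * y ^ (2 * d) + y ^ (3 * d))"

end

(*
  Take 0 < t < 1/2. On the branches x = t y^d and x = -t y^d of the polar curve, f_t takes the
  values (1 - 2t^3) y^(3d) and (1 + 2t^3) y^(3d). Near such a point p at height y = e, the fibre of
  f_t through p contains two points over the same y', at distance O(e^d), which are joined inside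
  the fibre within a ball of radius about e^(3/2), but not within a much smaller one. A bi-Hoelder
  conjugation with exponent 9/10 preserves this phenomenon, and in the fibre of f_s it only occurs
  near a branch point of the projection to y. Hence f_t(p) = (1 - 2s^3) v^(3d) or
  (1 + 2s^3) v^(3d) for some v within o(e) of the y-coordinate of the image of p. Comparing the two
  polar branches, which are O(e^d) apart, gives
  (1 + 2t^3)/(1 - 2t^3) = ((1 + 2s^3)/(1 - 2s^3))^j for some j in {-1, 0, 1}, so t = s.
*)
theory Submission
  imports Defs "HOL-Real_Asymp.Real_Asymp"
begin

section \<open>Continuous roots of a depressed cubic over a contractible base\<close>

lemma continuous_root_on_contractible:
  fixes f :: "'a::real_normed_vector \<Rightarrow> complex"
  assumes "continuous_on S f" "contractible S" "\<And>z. z \<in> S \<Longrightarrow> f z \<noteq> 0" "n > 0"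
  obtains g where "continuous_on S g" "\<And>z. z \<in> S \<Longrightarrow> g z ^ n = f z"
proof -
  obtain l where l: "continuous_on S l" "\<And>z. z \<in> S \<Longrightarrow> f z = exp (l z)"
    using continuous_logarithm_on_contractible[OF assms(1-3)] by metis
  show ?thesis
  proof
    show "continuous_on S (\<lambda>z. exp (l z / of_nat n))"
      using \<open>n > 0\<close> by (intro continuous_intros l) auto
    show "exp (l z / of_nat n) ^ n = f z" if "z \<in> S" for z
      using l(2)[OF that] \<open>n > 0\<close> by (simp flip: exp_of_nat_mult)
  qed
qed

text \<open>Cardano's identity: \<open>w\<close> is a primitive cube root of unity. It is applied
  with \<open>A * B\<close> = a^2 and \<open>A ^ 3 + B ^ 3\<close> = b, so the three factors exhibit
  the roots of x^3 - 3 a^2 x = b.\<close>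

lemma cubic_factorization:
  fixes A B w x :: complex
  assumes "w\<^sup>2 + w + 1 = 0"
  shows "x ^ 3 - 3 * (A * B) * x - (A ^ 3 + B ^ 3) =
    (x - (A + B)) * (x - (w * A + w\<^sup>2 * B)) * (x - (w\<^sup>2 * A + w * B))"
  using assms by algebra

text \<open>Cardano's formula has continuous branches over a contractible set on which neither the
  discriminant nor \<open>a\<close> vanishes.\<close>

lemma cubic_sheet:
  fixes D :: "complex set" and a b :: "complex \<Rightarrow> complex" and S :: "(complex \<times> complex) set"
  assumes D: "contractible D" and a: "continuous_on D a" and b: "continuous_on D b"
    and a0: "\<And>y. y \<in> D \<Longrightarrow> a y \<noteq> 0"
    and disc: "\<And>y. y \<in> D \<Longrightarrow> b y \<noteq> 2 * a y ^ 3 \<and> b y \<noteq> - 2 * a y ^ 3"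
    and S: "connected S"
    and SD: "\<And>x y. (x, y) \<in> S \<Longrightarrow> y \<in> D \<and> x ^ 3 - 3 * (a y)\<^sup>2 * x = b y"
    and p: "(x1, y1) \<in> S"
  obtains h where "continuous_on D h" "\<And>y. y \<in> D \<Longrightarrow> h y ^ 3 - 3 * (a y)\<^sup>2 * h y = b y"
    "\<And>x y. (x, y) \<in> S \<Longrightarrow> x = h y"
proof -
  have disc0: "(b y)\<^sup>2 - 4 * a y ^ 6 \<noteq> 0" if "y \<in> D" for y
  proof -
    have "(b y)\<^sup>2 - 4 * a y ^ 6 = (b y - 2 * a y ^ 3) * (b y + 2 * a y ^ 3)" by algebra
    then show ?thesis using disc[OF that] by (simp add: eq_neg_iff_add_eq_0)
  qed
  have "continuous_on D (\<lambda>y. (b y)\<^sup>2 - 4 * a y ^ 6)"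
    by (intro continuous_intros a b)
  from continuous_root_on_contractible[OF this D disc0, of 2]
  obtain q where q: "continuous_on D q" "\<And>y. y \<in> D \<Longrightarrow> q y ^ 2 = (b y)\<^sup>2 - 4 * a y ^ 6"
    by auto
  have q0: "q y \<noteq> 0" if "y \<in> D" for y
    using q(2)[OF that] disc0[OF that] by auto
  have bq: "((b y + q y) / 2) * ((b y - q y) / 2) = a y ^ 6" if "y \<in> D" for y
    using q(2)[OF that] by (simp add: field_simps power2_eq_square)
  have bq0: "(b y + q y) / 2 \<noteq> 0" if "y \<in> D" for y
    using a0[OF that] bq[OF that] by (metis mult_zero_left power_eq_0_iff)
  have "continuous_on D (\<lambda>y. (b y + q y) / 2)"
    by (intro continuous_intros b q) auto
  from continuous_root_on_contractible[OF this D bq0, of 3]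
  obtain A where A: "continuous_on D A" "\<And>y. y \<in> D \<Longrightarrow> A y ^ 3 = (b y + q y) / 2"
    by auto
  have A0: "A y \<noteq> 0" if "y \<in> D" for y
    using A(2)[OF that] bq0[OF that] by auto
  \<comment> \<open>Defining \<open>B\<close> as a quotient forces \<open>A y * B y\<close> = a^2.
    An independent cube root of (b - q)/2 could be off by a cube root of unity.\<close>
  define B where "B y = (a y)\<^sup>2 / A y" for y
  have B: "continuous_on D B" unfolding B_def using A0 by (intro continuous_intros a A) auto
  have AB: "A y * B y = (a y)\<^sup>2" if "y \<in> D" for y
    using A0[OF that] by (simp add: B_def)
  have B3: "B y ^ 3 = (b y - q y) / 2" if "y \<in> D" for y
  proof -
    have "A y ^ 3 * B y ^ 3 = a y ^ 6"
      using AB[OF that] by (simp flip: power_mult_distrib power_mult)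
    also have "\<dots> = A y ^ 3 * ((b y - q y) / 2)" by (simp only: bq[OF that] A(2)[OF that])
    finally show ?thesis using A0[OF that] by simp
  qed
  define w where "w = Complex (- 1 / 2) (sqrt 3 / 2)"
  have w: "w\<^sup>2 + w + 1 = 0"
    by (simp add: w_def complex_eq_iff power2_eq_square)
  \<comment> \<open>The three Cardano roots; \<open>w ^ (2 * k)\<close> stands for w^(-k), since w^3
    = 1.\<close>
  define r where "r = (\<lambda>(k::nat) y. w ^ k * A y + w ^ (2 * k) * B y)"
  have w6: "w ^ 6 = 1" using w by algebra
  have w4: "w ^ 4 = w" using w by algebra
  have AB3': "A y ^ 3 + B y ^ 3 = b y" if "y \<in> D" for y
    unfolding A(2)[OF that] B3[OF that] by (simp add: field_simps)
  have fac: "x ^ 3 - 3 * (a y)\<^sup>2 * x - b y = (x - r 0 y) * (x - r 1 y) * (x - r 2 y)"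
    if "y \<in> D" for x y
    using cubic_factorization[OF w, of x "A y" "B y"] w4
    unfolding AB[OF that] AB3'[OF that] by (simp add: r_def)
  have r: "continuous_on D (r k)" for k
    unfolding r_def by (intro continuous_intros A B)
  have AB3: "A y ^ 3 \<noteq> B y ^ 3" if "y \<in> D" for y
    unfolding A(2)[OF that] B3[OF that] using q0[OF that] by (simp add: field_simps)
  have w1: "w \<noteq> 1" using w by auto
  \<comment> \<open>Two of the roots can coincide only if A^3 = B^3, that is q = 0, which the
    discriminant hypothesis excludes.\<close>
  have dist: "r 0 y \<noteq> r 1 y" "r 0 y \<noteq> r 2 y" "r 1 y \<noteq> r 2 y" if "y \<in> D" for y
  proof -
    have "(1 - w) * (A y - w\<^sup>2 * B y) = A y + B y - (w * A y + w\<^sup>2 * B y)"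
      using w by algebra
    moreover have "(1 - w) * (B y - w\<^sup>2 * A y) = A y + B y - (w\<^sup>2 * A y + w * B y)"
      using w by algebra
    moreover have "w * ((1 - w) * (A y - B y)) = w * A y + w\<^sup>2 * B y - (w\<^sup>2 * A y + w * B y)"
      by algebra
    moreover have "r 0 y = A y + B y" "r 1 y = w * A y + w\<^sup>2 * B y" "r 2 y = w\<^sup>2 * A y + w * B y"
      by (simp_all add: r_def w4)
    moreover have "A y \<noteq> w\<^sup>2 * B y" "B y \<noteq> w\<^sup>2 * A y" "A y \<noteq> B y"
      using AB3[OF that] w6 by (auto simp: power_mult_distrib simp flip: power_mult)
    ultimately show "r 0 y \<noteq> r 1 y" "r 0 y \<noteq> r 2 y" "r 1 y \<noteq> r 2 y"
      using w1 w by auto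
  qed
  have roots: "\<exists>k\<in>{0,1,2}. x = r k y" if "(x, y) \<in> S" for x y
    using SD[OF that] fac[of y x] by auto
  obtain k where k: "k \<in> {0,1,2}" "x1 = r k y1" using roots[OF p] by auto
  \<comment> \<open>\<open>P k\<close> is the part of \<open>S\<close> on the k-th sheet. These
    parts are closed in \<open>S\<close>, pairwise disjoint and cover \<open>S\<close>, so
    connectedness leaves only the sheet that contains the given point.\<close>
  define P where "P k = {z \<in> S. fst z - r k (snd z) = 0}" for k
  have cl: "closedin (top_of_set S) (P k)" for k
  proof -
    have "continuous_on S (\<lambda>z. fst z - r k (snd z))"
      by (intro continuous_intros continuous_on_compose2[OF r]) (use SD in auto)
    then show ?thesis unfolding P_def
      using continuous_closedin_preimage_constant by blast
  qed
  define Q where "Q = (\<Union>j\<in>{0,1,2}-{k}. P j)"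
  have "closedin (top_of_set S) Q" unfolding Q_def using cl by (intro closedin_Union) auto
  moreover have "P k \<inter> Q = {}"
    using dist SD k(1) by (fastforce simp: P_def Q_def)
  moreover have "S \<subseteq> P k \<union> Q" using roots by (fastforce simp: P_def Q_def)
  moreover have "P k \<noteq> {}" using p k by (auto simp: P_def)
  ultimately have "Q = {}" using S cl[of k] unfolding connected_closedin by blast
  then have "x = r k y" if "(x, y) \<in> S" for x y
    using \<open>S \<subseteq> P k \<union> Q\<close> that by (auto simp: P_def)
  moreover have "r k y ^ 3 - 3 * (a y)\<^sup>2 * r k y = b y" if "y \<in> D" for y
    using fac[OF that, of "r k y"] k(1) by auto
  ultimately show ?thesis using that r by blast
qed

section \<open>Sheets of the fibres of f_s over the y-line\<close>

text \<open>The equation f_s = c is the cubic above with a = s y^d and b = c - y^(3d). Its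
  discriminant vanishes where b = 2 a^3 or b = -2 a^3, which are the two conditions in
  \<open>nb\<close>: there the fibre meets a polar branch. Away from these points a connected piece
  of the fibre lies on a graph, so it has at most one point over each y.\<close>

lemma fibre_sheet:
  fixes s c y0 :: complex and S :: "(complex \<times> complex) set"
  assumes "s \<noteq> 0" "0 \<notin> ball y0 R"
    and nb: "\<And>y. y \<in> ball y0 R \<Longrightarrow> y ^ (3 * d) * (1 - 2 * s ^ 3) \<noteq> c \<and> y ^ (3 * d) * (1 + 2 * s ^ 3) \<noteq> c"
    and S: "connected S" "\<And>x y. (x, y) \<in> S \<Longrightarrow> y \<in> ball y0 R \<and> f_germ d s (x, y) = c"
    and p: "(x1, y1) \<in> S"
  obtains h where "continuous_on (ball y0 R) h" "\<And>y. y \<in> ball y0 R \<Longrightarrow> f_germ d s (h y, y) = c"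
    "\<And>x y. (x, y) \<in> S \<Longrightarrow> x = h y"
proof -
  define a where "a = (\<lambda>y. s * y ^ d)"
  define b where "b = (\<lambda>y. c - y ^ (3 * d))"
  have f: "f_germ d s (x, y) = c \<longleftrightarrow> x ^ 3 - 3 * (a y)\<^sup>2 * x = b y" for x y
    by (auto simp: f_germ_def a_def b_def power_mult_distrib power_mult mult_ac
        power_commutes algebra_simps simp flip: power_mult)
  have a3: "a y ^ 3 = s ^ 3 * y ^ (3 * d)" for y
    by (simp add: a_def power_mult_distrib mult.commute flip: power_mult)
  have "a y \<noteq> 0" if "y \<in> ball y0 R" for y
    using that assms(1,2) by (auto simp: a_def)
  moreover have "b y \<noteq> 2 * a y ^ 3 \<and> b y \<noteq> - 2 * a y ^ 3" if "y \<in> ball y0 R" for y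
    using nb[OF that] unfolding a3 b_def by (auto simp: algebra_simps)
  moreover have "continuous_on (ball y0 R) a" "continuous_on (ball y0 R) b"
    unfolding a_def b_def by (intro continuous_intros)+
  moreover have "contractible (ball y0 R)" by (simp add: convex_imp_contractible)
  moreover have "y \<in> ball y0 R \<and> x ^ 3 - 3 * (a y)\<^sup>2 * x = b y" if "(x, y) \<in> S" for x y
    using S(2)[OF that] f by simp
  ultimately show ?thesis
    using cubic_sheet[of "ball y0 R" a b S x1 y1] S(1) p that unfolding f by blast
qed


text \<open>The cubic term dominates: if |x| > 2m, then 4 |x| m^2 \<le> |x|^3 \<le> 2 m^3 + (3/4)
  |x| m^2 \<le> (7/4) |x| m^2, which forces m = 0 and then x = 0. This controls x on a fibre by the
  size of y and of the value alone.\<close>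

lemma f_germ_root_bound:
  assumes s: "norm s \<le> 1 / 2" and y: "norm y ^ d \<le> m" and c: "norm (f_germ d s (x, y)) \<le> m ^ 3"
  shows "norm x \<le> 2 * m"
proof (rule ccontr)
  assume "\<not> ?thesis"
  then have n: "norm x > 2 * m" by simp
  have m: "m \<ge> 0" using y order_trans[OF zero_le_power[OF norm_ge_zero]] by blast
  have "x ^ 3 = f_germ d s (x, y) + 3 * s\<^sup>2 * x * y ^ (2 * d) - y ^ (3 * d)"
    by (simp add: f_germ_def)
  then have "norm x ^ 3 \<le> norm (f_germ d s (x, y) + 3 * s\<^sup>2 * x * y ^ (2 * d)) + norm (y ^ (3 * d))"
    by (metis norm_power norm_triangle_ineq4)
  moreover have "norm (f_germ d s (x, y) + 3 * s\<^sup>2 * x * y ^ (2 * d)) \<le>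
      norm (f_germ d s (x, y)) + norm (3 * s\<^sup>2 * x * y ^ (2 * d))"
    by (rule norm_triangle_ineq)
  moreover have "norm (y ^ (3 * d)) \<le> m ^ 3"
    using power_mono[OF y, of 3] by (simp add: norm_power mult.commute flip: power_mult)
  moreover have "norm (3 * s\<^sup>2 * x * y ^ (2 * d)) \<le> 3 / 4 * norm x * m\<^sup>2"
  proof -
    have "norm y ^ (2 * d) \<le> m\<^sup>2"
      using power_mono[OF y, of 2] by (simp add: norm_power mult.commute flip: power_mult)
    moreover have "(norm s)\<^sup>2 \<le> 1 / 4"
      using power_mono[OF s, of 2] by (simp add: power2_eq_square)
    ultimately have "(norm s)\<^sup>2 * norm y ^ (2 * d) \<le> 1 / 4 * m\<^sup>2"
      by (intro mult_mono) auto
    then have "3 * norm x * ((norm s)\<^sup>2 * norm y ^ (2 * d)) \<le> 3 * norm x * (1 / 4 * m\<^sup>2)"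
      by (intro mult_left_mono) auto
    then show ?thesis by (simp add: norm_mult norm_power algebra_simps)
  qed
  ultimately have le: "norm x ^ 3 \<le> 2 * m ^ 3 + 3 / 4 * norm x * m\<^sup>2" using c by simp
  have "norm x * (2 * m)\<^sup>2 \<le> norm x * (norm x)\<^sup>2"
    using n m by (intro mult_left_mono power_mono) auto
  moreover have "2 * m * m\<^sup>2 \<le> norm x * m\<^sup>2" using n by (intro mult_right_mono) auto
  ultimately have "norm x * m\<^sup>2 \<le> 0"
    using le by (simp add: power2_eq_square power3_eq_cube)
  then have "m = 0" using n m by (auto simp: mult_le_0_iff)
  with le n show False by (simp add: power_le_zero_eq)
qed

section \<open>The vanishing arc near a polar branch, at height 1 and at height e\<close>

text \<open>The branch points of this fibre, together with 0, form a finite set \<open>F\<close>, so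
  those other than 1 stay away from 1. A point of the disc around \<open>y'\<close> has distance
  strictly between \<delta>/2 and 3\<delta>/2 from 1, so it avoids 1 as well as the rest of
  \<open>F\<close>.\<close>

lemma no_nearby_branch_points:
  fixes t :: real and n :: nat
  assumes "n > 0" "norm t < 1 / 2"
  obtains e where "e > 0" "\<And>(\<delta>::real) (y'::complex) y. \<lbrakk>0 < \<delta>; \<delta> < e; norm (y' - 1) = \<delta>; y \<in> ball y' (\<delta> / 2)\<rbrakk> \<Longrightarrow>
    y \<noteq> 0 \<and> y ^ n * (1 - 2 * of_real t ^ 3) \<noteq> 1 - 2 * of_real t ^ 3 \<and>
    y ^ n * (1 + 2 * of_real t ^ 3) \<noteq> 1 - 2 * of_real t ^ 3"
proof -
  define a :: complex where "a = 2 * of_real t ^ 3"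
  have "norm a < 1"
  proof -
    have "norm t ^ 3 < (1 / 2) ^ 3" using assms by (intro power_strict_mono) auto
    then show ?thesis by (simp add: a_def norm_mult norm_power power_divide)
  qed
  then have a: "1 - a \<noteq> 0" "1 + a \<noteq> 0"
    by (auto simp: add_eq_0_iff)
  define F where "F = {y::complex. y ^ n = 1} \<union> {y. y ^ n = (1 - a) / (1 + a)} \<union> {0}"
  have "finite F" using assms by (auto simp: F_def intro: finite_nth_roots)
  then obtain e where e: "e > 0" "\<And>y. y \<in> F \<Longrightarrow> y \<noteq> 1 \<Longrightarrow> e \<le> dist 1 y"
    using finite_set_avoid[of F 1] by blast
  show ?thesis
  proof
    show "e / 2 > 0" using e by simp
    fix \<delta> :: real and y' y :: complex
    assume h: "0 < \<delta>" "\<delta> < e / 2" "norm (y' - 1) = \<delta>" "y \<in> ball y' (\<delta> / 2)"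
    have "dist y' 1 \<le> dist y' y + dist 1 y" "dist 1 y \<le> dist y' 1 + dist y' y"
      by (metis dist_commute dist_triangle)+
    with h have "dist 1 y > 0" "dist 1 y < e" by (auto simp: dist_norm)
    then have "y \<notin> F" using e(2)[of y] by auto
    then show "y \<noteq> 0 \<and> y ^ n * (1 - 2 * of_real t ^ 3) \<noteq> 1 - 2 * of_real t ^ 3 \<and>
    y ^ n * (1 + 2 * of_real t ^ 3) \<noteq> 1 - 2 * of_real t ^ 3"
      using a by (auto simp: F_def eq_divide_eq simp flip: a_def)
  qed
qed

lemma f_germ_of_real:
  "f_germ d (of_real t) (of_real x, of_real y) = of_real (x ^ 3 - 3 * t\<^sup>2 * x * y ^ (2 * d) + y ^ (3 * d))"
  by (simp add: f_germ_def)

text \<open>The arc is \<open>x = 2 t cos(\<pi>/3 + \<phi>) y^d\<close> with \<open>y^(3d) = (1 - 2t\<^sup>3) / (1 - 2t\<^sup>3 cos 3\<phi>)\<close>, where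
  the even function \<open>y\<close> of \<open>\<phi>\<close> takes the same value at both ends.\<close>

lemma vanishing_arc:
  fixes t :: real
  assumes "d > 0" "t \<noteq> 0" "norm t < 1 / 2"
  obtains e where "e > 0" "\<And>\<delta>. \<lbrakk>0 < \<delta>; \<delta> < e\<rbrakk> \<Longrightarrow> \<exists>S x1 x2 y'.
    connected S \<and> (of_real t, 1) \<in> S \<and> (x1, y') \<in> S \<and> (x2, y') \<in> S \<and> x1 \<noteq> x2 \<and>
    norm (y' - 1) = \<delta> \<and>
    (\<forall>x y. (x, y) \<in> S \<longrightarrow> f_germ d (of_real t) (x, y) = 1 - 2 * of_real t ^ 3 \<and>
       norm (y - 1) \<le> \<delta> \<and> norm x \<le> 2)"
proof -
  define n where "n = 3 * d"
  have n: "n > 0" using assms by (simp add: n_def)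
  define a where "a = 2 * t ^ 3"
  have "norm t ^ 3 < (1 / 2) ^ 3" using assms by (intro power_strict_mono) auto
  then have a: "norm a < 1 / 4" "a \<noteq> 0" using assms by (auto simp: a_def abs_mult power_abs power_divide)
  \<comment> \<open>\<open>v k\<close> is the value of cos 3\<phi> at which the arc has height
    \<open>k\<close>: it solves k^n (1 - a v) = 1 - a.\<close>
  define v where "v = (\<lambda>k::real. (1 - (1 - a) / k ^ n) / a)"
  have "isCont v 1" unfolding v_def using a by (intro continuous_intros) auto
  moreover have v1: "v 1 = 1" using a by (simp add: v_def)
  ultimately have "\<forall>\<^sub>F k in nhds 1. v k > 0"
    by (metis isCont_def order_tendstoD(1) tendsto_nhds_iff zero_less_one)
  then obtain e where e: "e > 0" "\<And>k. dist k 1 < e \<Longrightarrow> v k > 0"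
    unfolding eventually_nhds_metric by auto
  define k where "k = (\<lambda>\<phi>. root n ((1 - a) / (1 - a * cos (3 * \<phi>))))"
  have ac: "norm (a * cos x) < 1 / 4" for x
    by (rule le_less_trans[of _ "norm a"]) (use a in \<open>auto simp: abs_mult mult_left_le\<close>)
  have acp: "1 - a * cos x > 3 / 4" "1 - a * cos x < 5 / 4" for x
    using ac[of x] by (auto simp: abs_less_iff)
  have kn: "k \<phi> ^ n = (1 - a) / (1 - a * cos (3 * \<phi>))" and k0: "k \<phi> > 0" for \<phi>
    using n a acp[of "3 * \<phi>"] by (auto simp: k_def)
  have kd: "k \<phi> ^ d \<le> 2" for \<phi>
  proof -
    have "k \<phi> ^ n \<le> 2 ^ 3"
      using acp[of "3 * \<phi>"] a unfolding kn by (auto simp: field_simps abs_less_iff)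
    then have "(k \<phi> ^ d) ^ 3 \<le> 2 ^ 3" by (simp add: n_def mult.commute flip: power_mult)
    then show ?thesis by (rule power_le_imp_le_base[of _ 2, simplified]) auto
  qed
  define X where "X = (\<lambda>\<phi>. t * (2 * cos (pi / 3 + \<phi>)) * k \<phi> ^ d)"
  have X: "norm (X \<phi>) \<le> 2" for \<phi>
  proof -
    have "norm (X \<phi>) = norm t * (2 * norm (cos (pi / 3 + \<phi>))) * k \<phi> ^ d"
      using k0[of \<phi>] by (simp add: X_def abs_mult power_abs)
    also have "\<dots> \<le> 1 / 2 * (2 * 1) * 2"
      using assms kd[of \<phi>] k0[of \<phi>] by (intro mult_mono) auto
    finally show ?thesis by simp
  qed
  have fX: "(X \<phi>) ^ 3 - 3 * t\<^sup>2 * X \<phi> * k \<phi> ^ (2 * d) + k \<phi> ^ (3 * d) = 1 - a" for \<phi>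
  proof -
    \<comment> \<open>By the triple angle formula, x^3 - 3 t^2 x y^(2d) equals -a cos(3\<phi>)
      y^(3d) on the arc, and the definition of \<open>k\<close> makes the total constant.\<close>
    have "cos (3 * (pi / 3 + \<phi>)) = - cos (3 * \<phi>)"
      by (simp add: distrib_left cos_add)
    then have "4 * cos (pi / 3 + \<phi>) ^ 3 - 3 * cos (pi / 3 + \<phi>) = - cos (3 * \<phi>)"
      by (simp only: cos_treble_cos[of "pi / 3 + \<phi>"])
    moreover have "(X \<phi>) ^ 3 - 3 * t\<^sup>2 * X \<phi> * k \<phi> ^ (2 * d) + k \<phi> ^ (3 * d) =
      k \<phi> ^ n * (1 + a * (4 * cos (pi / 3 + \<phi>) ^ 3 - 3 * cos (pi / 3 + \<phi>)))"
      unfolding X_def n_def a_def power_mult mult.commute[of _ d]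
      by (simp add: algebra_simps power2_eq_square power3_eq_cube)
    ultimately show ?thesis
      using acp[of "3 * \<phi>"] by (simp add: kn)
  qed
  show ?thesis
  proof
    show "min e (1 / 2) > 0" using e by simp
    fix \<delta> :: real
    assume \<delta>: "0 < \<delta>" "\<delta> < min e (1 / 2)"
    \<comment> \<open>As cos 3\<phi> decreases from 1, the height moves down from 1 if a > 0 and up
      if a < 0. \<open>\<kappa>\<close> is the height at distance \<delta> from 1 on the side so
      reached.\<close>
    define \<kappa> where "\<kappa> = 1 - sgn a * \<delta>"
    have \<kappa>: "\<kappa> > 0" "norm (\<kappa> - 1) = \<delta>"
      using \<delta> a by (auto simp: \<kappa>_def sgn_if abs_mult)
    have v0: "v \<kappa> > 0" using e(2)[of \<kappa>] \<kappa> \<delta> by (simp add: dist_norm)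
    have v1: "v \<kappa> < 1"
    proof (cases "a > 0")
      case True
      then have "\<kappa> ^ n < 1" using \<kappa> \<delta> n by (intro power_less_one_iff[THEN iffD2]) (auto simp: \<kappa>_def)
      then have "1 - a < (1 - a) / \<kappa> ^ n"
        using mult_strict_left_mono[of "\<kappa> ^ n" 1 "1 - a"] acp[of 0] \<kappa>
        by (simp add: less_divide_eq)
      then show ?thesis using True by (simp add: v_def divide_less_eq)
    next
      case False
      then have "\<kappa> ^ n > 1" using a \<delta> n by (intro one_less_power) (auto simp: \<kappa>_def sgn_if)
      then have "(1 - a) / \<kappa> ^ n < 1 - a"
        using mult_strict_left_mono[of 1 "\<kappa> ^ n" "1 - a"] False \<kappa>
        by (simp add: divide_less_eq)
      then have "a < 1 - (1 - a) / \<kappa> ^ n" by linarith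
      then show ?thesis using False a by (simp add: v_def)
    qed
    define \<psi> where "\<psi> = arccos (v \<kappa>) / 3"
    have c3: "cos (3 * \<psi>) = v \<kappa>" using v0 v1 by (simp add: \<psi>_def)
    have \<psi>: "0 < \<psi>" "3 * \<psi> \<le> pi"
      using v0 v1 arccos_lt_bounded[of "v \<kappa>"] by (auto simp: \<psi>_def)
    have avk: "1 - a * v \<kappa> = (1 - a) / \<kappa> ^ n" using a by (simp add: v_def)
    have k\<psi>: "k \<psi> = \<kappa>" "k (- \<psi>) = \<kappa>"
    proof -
      have "(1 - a) / ((1 - a) / \<kappa> ^ n) = \<kappa> ^ n" using a \<kappa> by (auto simp: field_simps)
      then show "k \<psi> = \<kappa>" "k (- \<psi>) = \<kappa>"
        using n \<kappa> c3 by (auto simp: k_def avk real_root_power_cancel)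
    qed
    have kb: "norm (k \<phi> - 1) \<le> \<delta>" if "\<phi> \<in> {-\<psi>..\<psi>}" for \<phi>
    proof -
      have "cos (3 * \<psi>) \<le> cos \<bar>3 * \<phi>\<bar>" using that \<psi> by (intro cos_monotone_0_pi_le) auto
      then have u: "v \<kappa> \<le> cos (3 * \<phi>)" "cos (3 * \<phi>) \<le> 1" using c3 by auto
      have kk: "\<kappa> ^ n = (1 - a) / (1 - a * v \<kappa>)" unfolding avk using a \<kappa> by (auto simp: field_simps)
      have pos: "1 - a * v \<kappa> > 0" "1 - a * cos (3 * \<phi>) > 0" "1 - a > 0"
        using acp[of "3 * \<psi>"] acp[of "3 * \<phi>"] acp[of 0] c3 by auto
      show ?thesis
      proof (cases "a > 0")
        case True
        have "\<kappa> ^ n \<le> k \<phi> ^ n" "k \<phi> ^ n \<le> 1 ^ n" unfolding kk kn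
          using u True pos by (auto intro!: divide_left_mono)
        then have "\<kappa> \<le> k \<phi>" "k \<phi> \<le> 1"
          using n k0[of \<phi>] \<kappa> power_mono_iff[of "k \<phi>" 1 n] by (auto simp: power_mono_iff)
        then show ?thesis using \<kappa> by auto
      next
        case False
        then have m: "a * cos (3 * \<phi>) \<le> a * v \<kappa>" "a * 1 \<le> a * cos (3 * \<phi>)"
          using u by (auto intro!: mult_left_mono_neg simp del: mult_1_right)
        have "k \<phi> ^ n \<le> \<kappa> ^ n" unfolding kk kn
          using m pos by (intro divide_left_mono mult_pos_pos) auto
        moreover have "1 ^ n \<le> k \<phi> ^ n" unfolding kn
          using m pos by (simp add: le_divide_eq)
        ultimately have "k \<phi> \<le> \<kappa>" "1 \<le> k \<phi>"
          using n k0[of \<phi>] \<kappa> power_mono_iff[of 1 "k \<phi>" n] by (auto simp: power_mono_iff)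
        then show ?thesis using \<kappa> by auto
      qed
    qed
    define S where "S = (\<lambda>\<phi>. (complex_of_real (X \<phi>), complex_of_real (k \<phi>))) ` {-\<psi>..\<psi>}"
    have "connected S"
    proof -
      have "continuous_on UNIV k" unfolding k_def
        using acp by (intro continuous_intros) (metis less_irrefl order_less_trans zero_less_divide_iff zero_less_numeral)
      then have "continuous_on {-\<psi>..\<psi>} k" by (rule continuous_on_subset) auto
      then show ?thesis unfolding S_def X_def
        by (intro connected_continuous_image continuous_intros) auto
    qed
    moreover have "(of_real t, 1) \<in> S"
    proof -
      have "k 0 = 1" "X 0 = t" using n a by (auto simp: k_def X_def cos_60)
      then show ?thesis unfolding S_def using \<psi> by (auto intro!: image_eqI[of _ _ 0])
    qed
    moreover have "(of_real (X \<psi>), of_real \<kappa>) \<in> S" "(of_real (X (-\<psi>)), of_real \<kappa>) \<in> S"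
      unfolding S_def using \<psi> k\<psi> by (auto intro: image_eqI[of _ _ \<psi>] image_eqI[of _ _ "-\<psi>"])
    \<comment> \<open>The two ends share the height \<open>\<kappa>\<close>, and their x-coordinates
      differ by a nonzero multiple of sin(pi/3) sin \<psi>.\<close>
    moreover have "complex_of_real (X \<psi>) \<noteq> of_real (X (-\<psi>))"
    proof -
      have "sin \<psi> > 0" using \<psi> by (intro sin_gt_zero) auto
      then show ?thesis
        using assms \<kappa> k\<psi> by (auto simp: X_def cos_add cos_diff sin_60)
    qed
    moreover have "norm (complex_of_real \<kappa> - 1) = \<delta>"
      using \<kappa> by (metis norm_of_real of_real_1 of_real_diff real_norm_def)
    moreover have "f_germ d (of_real t) (x, y) = 1 - 2 * of_real t ^ 3 \<and>
       norm (y - 1) \<le> \<delta> \<and> norm x \<le> 2" if "(x, y) \<in> S" for x y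
    proof -
      obtain \<phi> where \<phi>: "\<phi> \<in> {-\<psi>..\<psi>}" "x = of_real (X \<phi>)" "y = of_real (k \<phi>)"
        using \<open>(x, y) \<in> S\<close> by (auto simp: S_def)
      have "f_germ d (of_real t) (x, y) = 1 - 2 * of_real t ^ 3"
        unfolding \<phi> f_germ_of_real fX a_def by simp
      moreover have "norm (y - 1) \<le> \<delta>"
        using kb[OF \<phi>(1)] unfolding \<phi> by (metis norm_of_real of_real_1 of_real_diff real_norm_def)
      ultimately show ?thesis using X[of \<phi>] by (simp add: \<phi>)
    qed
    ultimately show "\<exists>S x1 x2 y'.
      connected S \<and> (of_real t, 1) \<in> S \<and> (x1, y') \<in> S \<and> (x2, y') \<in> S \<and> x1 \<noteq> x2 \<and>
      norm (y' - 1) = \<delta> \<and>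
      (\<forall>x y. (x, y) \<in> S \<longrightarrow> f_germ d (of_real t) (x, y) = 1 - 2 * of_real t ^ 3 \<and>
         norm (y - 1) \<le> \<delta> \<and> norm x \<le> 2)"
      by blast
  qed
qed

text \<open>Weighted homogeneity, with weights d and 1 and degree 3d, carries the arc from height 1
  to height e.\<close>

lemma f_germ_scale:
  "f_germ d t (k ^ d * x, k * y) = k ^ (3 * d) * f_germ d t (x, y)"
proof -
  have "k ^ (3 * d) = (k ^ d) ^ 3" "k ^ (2 * d) = (k ^ d)\<^sup>2"
    by (simp_all add: mult.commute flip: power_mult)
  then show ?thesis
    by (simp add: f_germ_def algebra_simps power_mult_distrib power2_eq_square power3_eq_cube)
qed

text \<open>The arc for \<delta> = e^(1/2), rescaled by e: heights spread over e \<delta> = e^(3/2),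
  while x-coordinates are O(e^d), hence O(e^2) as d \<ge> 2. The ends are thus much closer to each
  other than to any branch point, and the gap between the exponents 2 and 3/2 has to absorb the
  Hoelder losses.\<close>

lemma scaled_vanishing_arc:
  fixes t :: real
  assumes d: "d \<ge> 2" and t: "t \<noteq> 0" "norm t < 1 / 2"
  shows "\<forall>\<^sub>F e in at_right 0. \<exists>S x1 x2 y'.
    connected S \<and> (of_real e ^ d * of_real t, of_real e) \<in> S \<and> (x1, y') \<in> S \<and> (x2, y') \<in> S \<and> x1 \<noteq> x2 \<and>
    norm (x1 - x2) \<le> 4 * e\<^sup>2 \<and>
    (\<forall>z\<in>S. f_germ d (of_real t) z = of_real e ^ (3 * d) * (1 - 2 * of_real t ^ 3) \<and>
       norm (z - (of_real e ^ d * of_real t, of_real e)) \<le> 4 * e powr (3/2) \<and> norm z \<le> 4 * e) \<and>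
    (\<forall>y\<in>ball y' (e powr (3/2) / 2). y \<noteq> 0 \<and>
       y ^ (3 * d) * (1 - 2 * of_real t ^ 3) \<noteq> of_real e ^ (3 * d) * (1 - 2 * of_real t ^ 3) \<and>
       y ^ (3 * d) * (1 + 2 * of_real t ^ 3) \<noteq> of_real e ^ (3 * d) * (1 - 2 * of_real t ^ 3))"
proof -
  have d0: "d > 0" "3 * d > 0" using d by auto
  obtain e1 where e1: "e1 > 0" "\<And>\<delta>. \<lbrakk>0 < \<delta>; \<delta> < e1\<rbrakk> \<Longrightarrow> \<exists>S x1 x2 y'.
    connected S \<and> (of_real t, 1) \<in> S \<and> (x1, y') \<in> S \<and> (x2, y') \<in> S \<and> x1 \<noteq> x2 \<and>
    norm (y' - 1) = \<delta> \<and>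
    (\<forall>x y. (x, y) \<in> S \<longrightarrow> f_germ d (of_real t) (x, y) = 1 - 2 * of_real t ^ 3 \<and>
       norm (y - 1) \<le> \<delta> \<and> norm x \<le> 2)"
    using vanishing_arc[OF d0(1) t] by blast
  obtain e2 where e2: "e2 > 0" "\<And>(\<delta>::real) (y'::complex) y. \<lbrakk>0 < \<delta>; \<delta> < e2; norm (y' - 1) = \<delta>; y \<in> ball y' (\<delta> / 2)\<rbrakk> \<Longrightarrow>
    y \<noteq> 0 \<and> y ^ (3 * d) * (1 - 2 * of_real t ^ 3) \<noteq> 1 - 2 * of_real t ^ 3 \<and>
    y ^ (3 * d) * (1 + 2 * of_real t ^ 3) \<noteq> 1 - 2 * of_real t ^ 3"
    using no_nearby_branch_points[OF d0(2) t(2)] by blast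
  have "\<forall>\<^sub>F e in at_right 0. e powr (1/2) < e1" "\<forall>\<^sub>F e in at_right 0. e powr (1/2) < e2"
    using e1(1) e2(1) by real_asymp+
  moreover have "\<forall>\<^sub>F e in at_right (0::real). e < 1" "\<forall>\<^sub>F e in at_right (0::real). e > 0"
    by real_asymp+
  ultimately show ?thesis
  proof eventually_elim
    case (elim e)
    define k where "k = complex_of_real e"
    define \<delta> where "\<delta> = e powr (1/2)"
    have \<delta>: "0 < \<delta>" "\<delta> < e1" "\<delta> < e2" "\<delta> \<le> 1"
      using elim by (auto simp: \<delta>_def powr_le1)
    have \<rho>: "e powr (3/2) = e * \<delta>"
      using elim by (simp add: \<delta>_def powr_mult_base)
    have e\<delta>: "e \<le> \<delta>"
      using elim powr_mono'[of "1/2" 1 e] by (simp add: \<delta>_def)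
    have k: "k \<noteq> 0" "norm k = e" using elim by (auto simp: k_def)
    have ed: "e ^ d \<le> e\<^sup>2" using elim d by (intro power_decreasing) auto
    obtain S x1 x2 y' where S: "connected S" "(of_real t, 1) \<in> S" "(x1, y') \<in> S" "(x2, y') \<in> S" "x1 \<noteq> x2"
      "norm (y' - 1) = \<delta>"
      "\<And>x y. (x, y) \<in> S \<Longrightarrow> f_germ d (of_real t) (x, y) = 1 - 2 * of_real t ^ 3 \<and>
         norm (y - 1) \<le> \<delta> \<and> norm x \<le> 2"
      using e1(2)[OF \<delta>(1,2)] by blast
    define g where "g = (\<lambda>z. (k ^ d * fst z, k * snd z))"
    have "connected (g ` S)"
      unfolding g_def by (intro connected_continuous_image continuous_intros S(1))
    moreover have "(k ^ d * of_real t, k) \<in> g ` S" "(k ^ d * x1, k * y') \<in> g ` S" "(k ^ d * x2, k * y') \<in> g ` S"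
      using S(2-4) by (force simp: g_def)+
    moreover have "k ^ d * x1 \<noteq> k ^ d * x2" using k S(5) by simp
    moreover have "norm (k ^ d * x1 - k ^ d * x2) \<le> 4 * e\<^sup>2"
    proof -
      have "norm (x1 - x2) \<le> 4"
        using norm_triangle_ineq4[of x1 x2] S(7)[OF S(3)] S(7)[OF S(4)] by simp
      then have "e ^ d * norm (x1 - x2) \<le> e\<^sup>2 * 4"
        using ed elim by (intro mult_mono) auto
      then show ?thesis using k by (simp add: norm_mult norm_power flip: right_diff_distrib)
    qed
    moreover have "f_germ d (of_real t) z = k ^ (3 * d) * (1 - 2 * of_real t ^ 3) \<and>
       norm (z - (k ^ d * of_real t, k)) \<le> 4 * e powr (3/2) \<and> norm z \<le> 4 * e" if "z \<in> g ` S" for z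
    proof -
      obtain x y where xy: "(x, y) \<in> S" "z = (k ^ d * x, k * y)"
        using \<open>z \<in> g ` S\<close> by (auto simp: g_def)
      note b = S(7)[OF xy(1)]
      have "norm (x - of_real t) \<le> 3"
        using norm_triangle_ineq4[of x "of_real t"] b t by simp
      then have 1: "e ^ d * norm (x - of_real t) \<le> e\<^sup>2 * 3"
        using ed elim by (intro mult_mono) auto
      have 2: "e * norm (y - 1) \<le> e * \<delta>" using b elim by (intro mult_left_mono) auto
      have 3: "e\<^sup>2 \<le> e * \<delta>" "e\<^sup>2 \<le> e" "e * \<delta> \<le> e"
        using elim e\<delta> \<delta> by (auto simp: power2_eq_square mult_left_le)
      have "z - (k ^ d * of_real t, k) = (k ^ d * (x - of_real t), k * (y - 1))"
        by (simp add: xy algebra_simps)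
      then have "norm (z - (k ^ d * of_real t, k)) \<le> e ^ d * norm (x - of_real t) + e * norm (y - 1)"
        using norm_Pair_le[of "k ^ d * (x - of_real t)" "k * (y - 1)"] k
        by (simp add: norm_mult norm_power)
      with 1 2 3 have "norm (z - (k ^ d * of_real t, k)) \<le> 4 * e powr (3/2)" unfolding \<rho> by linarith
      moreover have "norm z \<le> 4 * e"
      proof -
        have "norm y \<le> 2" using norm_triangle_ineq2[of y 1] b \<delta> by simp
        then have "e * norm y \<le> e * 2" using elim by (intro mult_left_mono) auto
        moreover have "e ^ d * norm x \<le> e\<^sup>2 * 2" using b ed elim by (intro mult_mono) auto
        moreover have "norm z \<le> e ^ d * norm x + e * norm y"
          using norm_Pair_le[of "k ^ d * x" "k * y"] k by (simp add: xy norm_mult norm_power)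
        ultimately show ?thesis using 3 by linarith
      qed
      ultimately show ?thesis using b by (simp add: xy f_germ_scale)
    qed
    moreover have "y \<noteq> 0 \<and>
       y ^ (3 * d) * (1 - 2 * of_real t ^ 3) \<noteq> k ^ (3 * d) * (1 - 2 * of_real t ^ 3) \<and>
       y ^ (3 * d) * (1 + 2 * of_real t ^ 3) \<noteq> k ^ (3 * d) * (1 - 2 * of_real t ^ 3)"
      if "y \<in> ball (k * y') (e powr (3/2) / 2)" for y
    proof -
      define u where "u = y / k"
      have y: "y = k * u" using k by (simp add: u_def)
      have "e * norm (y' - u) = norm (k * y' - y)"
        using k by (simp add: y norm_mult flip: right_diff_distrib)
      also have "\<dots> < e * (\<delta> / 2)" using that \<rho> by (simp add: dist_norm)
      finally have "u \<in> ball y' (\<delta> / 2)" using elim by (simp add: dist_norm)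
      from e2(2)[OF \<delta>(1,3) S(6) this] show ?thesis
        using k by (auto simp: y power_mult_distrib mult.assoc)
    qed
    ultimately show ?case unfolding k_def by blast
  qed
qed

section \<open>Transport of the arc by a bi-Hoelder conjugation\<close>

text \<open>The exponents fit as follows. Under \<open>H\<close>, the radius O(e^(3/2)) of the arc
  becomes O(e^(27/20)), which is o(e), and the distance O(e^2) of its ends becomes O(e^(9/5)). A
  replacement arc of size e^(17/10) between the images of the ends comes back under
  \<open>H'\<close> with size O(e^(153/100)), still below e^(3/2)/2.\<close>

lemma branch_point_near_image:
  fixes t s C r :: real and H H' :: "complex \<times> complex \<Rightarrow> complex \<times> complex"
  assumes d: "d \<ge> 2" and t: "t \<noteq> 0" "norm t < 1 / 2" and s: "s \<noteq> 0" "norm s < 1 / 2"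
    and C: "C > 0" and r: "r > 0" "ball 0 r \<subseteq> U" "ball 0 r \<subseteq> V"
    and hom: "homeomorphism U V H H'" and H0: "H 0 = 0"
    and HC: "\<And>a b. \<lbrakk>a \<in> U; b \<in> U\<rbrakk> \<Longrightarrow> norm (H a - H b) \<le> C * norm (a - b) powr (9/10)"
    and HC': "\<And>a b. \<lbrakk>a \<in> V; b \<in> V\<rbrakk> \<Longrightarrow> norm (H' a - H' b) \<le> C * norm (a - b) powr (9/10)"
    and fH: "\<And>z. z \<in> ball 0 r \<Longrightarrow> f_germ d (of_real t) z = f_germ d (of_real s) (H z)"
  shows "\<forall>\<^sub>F e in at_right 0. \<exists>y. norm (y - snd (H (of_real e ^ d * of_real t, of_real e))) < 2 * C * (4 * e powr (3/2)) powr (9/10) \<and>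
    (y ^ (3 * d) * (1 - 2 * of_real s ^ 3) = of_real e ^ (3 * d) * (1 - 2 * of_real t ^ 3) \<or>
     y ^ (3 * d) * (1 + 2 * of_real s ^ 3) = of_real e ^ (3 * d) * (1 - 2 * of_real t ^ 3))"
proof -
  \<comment> \<open>\<open>R\<close> is twice the Hoelder bound for the image of the arc about
    \<open>H p\<close>, so that this image lies over an open disc. \<open>h\<close> bounds |H z| on
    the arc, and \<open>m\<close> dominates |y|^d for |y| \<le> h as well as the cube root of the
    fibre value. \<open>\<tau>\<close> bounds the replacement arc and \<open>\<sigma>\<close> its
    preimage.\<close>
  define R where "R = (\<lambda>e. 2 * C * (4 * e powr (3/2)) powr (9/10))"
  define h where "h = (\<lambda>e. C * (4 * e) powr (9/10))"
  define m where "m = (\<lambda>e. (h e)\<^sup>2 + 2 * e\<^sup>2)"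
  define \<tau> where "\<tau> = (\<lambda>e::real. e powr (17/10))"
  define \<sigma> where "\<sigma> = (\<lambda>e. C * \<tau> e powr (9/10))"
  note defs = R_def h_def m_def \<tau>_def \<sigma>_def
  have "\<forall>\<^sub>F e in at_right 0. R e < 1" "\<forall>\<^sub>F e in at_right 0. h e < 1"
    "\<forall>\<^sub>F e in at_right 0. C * (3 * R e + 4 * e\<^sup>2) powr (9/10) < e"
    "\<forall>\<^sub>F e in at_right 0. h e + \<tau> e < r" "\<forall>\<^sub>F e in at_right 0. \<sigma> e < e powr (3/2) / 2"
    "\<forall>\<^sub>F e in at_right 0. 4 * e + \<sigma> e < r"
    unfolding defs using C r(1) by real_asymp+
  moreover have "\<forall>\<^sub>F e in at_right (0::real). e < 1" "\<forall>\<^sub>F e in at_right (0::real). e > 0"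
    by real_asymp+
  moreover have "\<forall>\<^sub>F e in at_right 0. 4 * m e + C * (4 * e\<^sup>2) powr (9/10) < \<tau> e"
    unfolding defs using C by real_asymp
  ultimately show ?thesis using scaled_vanishing_arc[OF d t]
  proof eventually_elim
    case (elim e)
    define c where "c = complex_of_real e ^ (3 * d) * (1 - 2 * of_real t ^ 3)"
    define p where "p = (complex_of_real e ^ d * of_real t, complex_of_real e)"
    note e = elim(7,8)
    obtain S x1 x2 y' where S: "connected S" "p \<in> S" "(x1, y') \<in> S" "(x2, y') \<in> S" "x1 \<noteq> x2"
      "norm (x1 - x2) \<le> 4 * e\<^sup>2"
      "\<And>z. z \<in> S \<Longrightarrow> f_germ d (of_real t) z = c"
      "\<And>z. z \<in> S \<Longrightarrow> norm (z - p) \<le> 4 * e powr (3/2)"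
      "\<And>z. z \<in> S \<Longrightarrow> norm z \<le> 4 * e"
      and nb: "\<And>y. y \<in> ball y' (e powr (3/2) / 2) \<Longrightarrow> y \<noteq> 0 \<and>
       y ^ (3 * d) * (1 - 2 * of_real t ^ 3) \<noteq> c \<and> y ^ (3 * d) * (1 + 2 * of_real t ^ 3) \<noteq> c"
      using elim(10) unfolding c_def p_def by blast
    have \<sigma>0: "\<sigma> e \<ge> 0" and h0: "h e \<ge> 0" and R0: "R e > 0"
      using C e by (auto simp: defs)
    have t3: "norm (1 - 2 * complex_of_real t ^ 3) \<le> 2"
    proof -
      have "norm t ^ 3 \<le> (1 / 2) ^ 3" using t by (intro power_mono) auto
      then show ?thesis
        using norm_triangle_ineq4[of 1 "2 * complex_of_real t ^ 3"]
        by (simp add: norm_mult norm_power power_divide)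
    qed
    have nc: "norm c \<le> (2 * e\<^sup>2) ^ 3"
    proof -
      have "norm c \<le> e ^ (3 * d) * 2"
        unfolding c_def norm_mult using t3 e by (intro mult_mono) (auto simp: norm_power)
      also have "\<dots> \<le> e ^ 6 * 8" using e d by (intro mult_mono power_decreasing) auto
      finally show ?thesis by (simp add: power_mult_distrib flip: power_mult)
    qed
    have SU: "S \<subseteq> ball 0 r"
      using S(9) elim(6) \<sigma>0 by fastforce
    then have U: "S \<subseteq> U" "0 \<in> U" using r by auto
    have Hh: "norm (H z) \<le> h e" if "z \<in> S" for z
    proof -
      have "norm (H z - H 0) \<le> C * norm (z - 0) powr (9/10)"
        using HC[OF subsetD[OF U(1) that] U(2)] by simp
      also have "\<dots> \<le> h e" unfolding h_def
        using C S(9)[OF that] by (intro mult_left_mono powr_mono2) auto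
      finally show ?thesis by (simp add: H0)
    qed
    have gH: "f_germ d (of_real s) (H z) = c" if "z \<in> S" for z
      using fH[OF subsetD[OF SU that]] S(7)[OF that] by simp
    define y0 where "y0 = snd (H p)"
    have near: "snd (H z) \<in> ball y0 (R e)" if "z \<in> S" for z
    proof -
      have "dist (snd (H z)) (snd (H p)) \<le> norm (H z - H p)"
        by (metis dist_norm dist_snd_le)
      also have "\<dots> \<le> C * norm (z - p) powr (9/10)"
        using HC[of z p] that U S(2) by blast
      also have "\<dots> \<le> C * (4 * e powr (3/2)) powr (9/10)"
        using C S(8)[OF that] by (intro mult_left_mono powr_mono2) auto
      also have "\<dots> < R e" using C e by (simp add: R_def)
      finally show ?thesis by (simp add: y0_def dist_commute)
    qed
    \<comment> \<open>If |y0| < R, the root bound gives |H p| = O(R), and then |p| = O(e^(243/200))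
      by the Hoelder bound for \<open>H'\<close>, contradicting |p| \<ge> e.\<close>
    have zero: "0 \<notin> ball y0 (R e)"
    proof
      assume "0 \<in> ball y0 (R e)"
      then have y0: "norm y0 < R e" by simp
      define m1 where "m1 = R e + 2 * e\<^sup>2"
      have "norm y0 ^ d \<le> norm y0" using power_decreasing[of 1 d "norm y0"] y0 elim(1) d by simp
      then have "norm y0 ^ d \<le> m1" using y0 zero_le_power2[of e] unfolding m1_def by linarith
      moreover have "norm (f_germ d (of_real s) (fst (H p), y0)) \<le> m1 ^ 3"
        using gH[OF S(2)] nc power_mono[of "2 * e\<^sup>2" m1 3] R0 by (simp add: y0_def m1_def)
      ultimately have "norm (fst (H p)) \<le> 2 * m1"
        using s by (intro f_germ_root_bound) auto
      then have "norm (H p) \<le> 3 * R e + 4 * e\<^sup>2"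
        using norm_Pair_le[of "fst (H p)" "snd (H p)"] y0 by (simp add: y0_def m1_def)
      moreover have "e \<le> C * norm (H p) powr (9/10)"
      proof -
        have "H p \<in> V" "H 0 \<in> V" "H' (H p) = p" "H' (H 0) = 0"
          using hom U S(2) by (auto simp: homeomorphism_def)
        then have "norm (p - 0) \<le> C * norm (H p - H 0) powr (9/10)"
          using HC'[of "H p" "H 0"] by simp
        moreover have "e \<le> norm p"
          using norm_snd_le[of "snd p" "fst p"] e by (simp add: p_def)
        ultimately show ?thesis by (simp add: H0)
      qed
      ultimately have "e \<le> C * (3 * R e + 4 * e\<^sup>2) powr (9/10)"
        using C by (smt (verit, best) mult_left_mono powr_mono2 norm_ge_zero divide_nonneg_nonneg)
      with elim(3) show False by simp
    qed
    have "\<exists>y\<in>ball y0 (R e). y ^ (3 * d) * (1 - 2 * of_real s ^ 3) = c \<or> y ^ (3 * d) * (1 + 2 * of_real s ^ 3) = c"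
    proof (rule ccontr)
      assume "\<not> ?thesis"
      then have nbs: "\<And>y. y \<in> ball y0 (R e) \<Longrightarrow> y ^ (3 * d) * (1 - 2 * of_real s ^ 3) \<noteq> c \<and> y ^ (3 * d) * (1 + 2 * of_real s ^ 3) \<noteq> c"
        by blast
      have contH: "continuous_on S H"
        using hom SU r by (meson continuous_on_subset homeomorphism_def order_trans)
      define q1 q2 where "q1 = (x1, y')" and "q2 = (x2, y')"
      have q: "q1 \<in> S" "q2 \<in> S" "norm (q2 - q1) \<le> 4 * e\<^sup>2"
        using S(3,4,6) by (auto simp: q1_def q2_def norm_Pair norm_minus_commute)
      have "connected (H ` S)" using contH S(1) by (rule connected_continuous_image)
      moreover have "y \<in> ball y0 (R e) \<and> f_germ d (of_real s) (x, y) = c" if "(x, y) \<in> H ` S" for x y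
        using that near gH by (metis (no_types, lifting) imageE snd_conv)
      moreover have "(fst (H p), snd (H p)) \<in> H ` S" using S(2) by simp
      \<comment> \<open>The images of \<open>q1\<close> and \<open>q2\<close> might a priori lie on
        different sheets; connectedness of the image of \<open>S\<close> puts them on a common
        one.\<close>
      ultimately obtain \<phi> where \<phi>: "continuous_on (ball y0 (R e)) \<phi>"
        "\<And>y. y \<in> ball y0 (R e) \<Longrightarrow> f_germ d (of_real s) (\<phi> y, y) = c"
        "\<And>x y. (x, y) \<in> H ` S \<Longrightarrow> x = \<phi> y"
        using fibre_sheet[of "of_real s" y0 "R e" d c "H ` S"] s(1) zero nbs by (metis of_real_eq_0_iff)
      define b1 b2 where "b1 = snd (H q1)" and "b2 = snd (H q2)"
      have b: "b1 \<in> ball y0 (R e)" "b2 \<in> ball y0 (R e)" "norm b1 \<le> h e" "norm b2 \<le> h e"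
        using near[OF q(1)] near[OF q(2)] Hh[OF q(1)] Hh[OF q(2)] dist_snd_le[of "H q1" 0] dist_snd_le[of "H q2" 0]
        by (auto simp: b1_def b2_def)
      have Hq: "H q1 = (\<phi> b1, b1)" "H q2 = (\<phi> b2, b2)"
        using \<phi>(3)[of "fst (H q1)" b1] \<phi>(3)[of "fst (H q2)" b2] q by (auto simp: b1_def b2_def prod_eq_iff)
      have seg: "closed_segment b1 b2 \<subseteq> ball y0 (R e)"
        using b by (meson closed_segment_subset convex_ball)
      have segh: "norm y \<le> h e" if "y \<in> closed_segment b1 b2" for y
        using that b closed_segment_subset[of b1 "cball 0 (h e)" b2] by auto
      \<comment> \<open>On a common sheet, the images of the end points are joined by the short arc \<open>T\<close>, whose
        preimage joins the end points without passing near the branch point.\<close>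
      define T where "T = (\<lambda>y. (\<phi> y, y)) ` closed_segment b1 b2"
      have "connected T" unfolding T_def
        by (intro connected_continuous_image continuous_intros continuous_on_subset[OF \<phi>(1) seg]) auto
      have bb: "norm (b2 - b1) \<le> C * (4 * e\<^sup>2) powr (9/10)"
      proof -
        have "norm (b2 - b1) \<le> norm (H q2 - H q1)"
          unfolding b1_def b2_def by (metis dist_norm dist_snd_le)
        also have "\<dots> \<le> C * norm (q2 - q1) powr (9/10)"
          using HC[of q2 q1] q U by blast
        also have "\<dots> \<le> C * (4 * e\<^sup>2) powr (9/10)"
          using C q(3) by (intro mult_left_mono powr_mono2) auto
        finally show ?thesis .
      qed
      \<comment> \<open>No modulus of continuity of the sheet is required: its absolute size over
        the segment is already O(e^(9/5)), because h^d \<le> h^2.\<close>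
      have \<phi>m: "norm (\<phi> y) \<le> 2 * m e" if "y \<in> closed_segment b1 b2" for y
      proof (rule f_germ_root_bound)
        show "norm (of_real s :: complex) \<le> 1 / 2" using s by simp
        have "norm y ^ d \<le> h e ^ d" using segh[OF that] by (intro power_mono) auto
        also have "\<dots> \<le> h e ^ 2" using elim(2) h0 d by (intro power_decreasing) auto
        finally show "norm y ^ d \<le> m e" using zero_le_power2[of e] unfolding m_def by linarith
        have "norm c \<le> m e ^ 3"
          using nc power_mono[of "2 * e\<^sup>2" "m e" 3] by (simp add: m_def)
        then show "norm (f_germ d (of_real s) (\<phi> y, y)) \<le> m e ^ 3"
          using \<phi>(2) seg that by auto
      qed
      have T\<tau>: "norm (z - H q1) \<le> \<tau> e" if "z \<in> T" for z
      proof -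
        obtain y where y: "y \<in> closed_segment b1 b2" "z = (\<phi> y, y)" using \<open>z \<in> T\<close> by (auto simp: T_def)
        have "norm (z - H q1) \<le> norm (\<phi> y - \<phi> b1) + norm (y - b1)"
          unfolding y Hq by (simp add: norm_Pair_le)
        moreover have "norm (\<phi> y - \<phi> b1) \<le> 4 * m e"
          using norm_triangle_ineq4[of "\<phi> y" "\<phi> b1"] \<phi>m[OF y(1)] \<phi>m[of b1] by simp
        moreover have "norm (y - b1) \<le> norm (b2 - b1)"
          using segment_bound[OF y(1)] by simp
        ultimately show ?thesis using bb elim(9) by linarith
      qed
      have TV: "T \<subseteq> V"
      proof
        fix z assume z: "z \<in> T"
        have "norm z \<le> norm (H q1) + norm (z - H q1)" by (metis add.commute diff_add_cancel norm_triangle_ineq)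
        then show "z \<in> V" using T\<tau>[OF z] Hh[OF q(1)] elim(4) r(3) by auto
      qed
      have H'q: "H' (H q1) = q1" "H' (H q2) = q2" "H q1 \<in> V"
        using hom q SU r by (auto simp: homeomorphism_def)
      have T\<sigma>: "norm (H' z - q1) \<le> \<sigma> e" if "z \<in> T" for z
      proof -
        have "norm (H' z - H' (H q1)) \<le> C * norm (z - H q1) powr (9/10)"
          using HC'[of z "H q1"] that TV H'q by auto
        also have "\<dots> \<le> \<sigma> e" unfolding \<sigma>_def
          using C T\<tau>[OF that] by (intro mult_left_mono powr_mono2) auto
        finally show ?thesis by (simp add: H'q)
      qed
      have "connected (H' ` T)"
        using hom TV \<open>connected T\<close> by (meson connected_continuous_image continuous_on_subset homeomorphism_def)
      moreover have "y \<in> ball y' (e powr (3/2) / 2) \<and> f_germ d (of_real t) (x, y) = c" if "(x, y) \<in> H' ` T" for x y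
      proof
        obtain z where z: "z \<in> T" "(x, y) = H' z" using \<open>(x, y) \<in> H' ` T\<close> by blast
        have "dist y y' \<le> norm (H' z - q1)"
          using dist_snd_le[of "H' z" q1] by (simp add: q1_def dist_norm flip: z(2))
        then show "y \<in> ball y' (e powr (3/2) / 2)"
          using T\<sigma>[OF z(1)] elim(5) by (simp add: dist_commute)
        have "norm (H' z) \<le> norm q1 + norm (H' z - q1)" by (metis add.commute diff_add_cancel norm_triangle_ineq)
        then have "H' z \<in> ball 0 r" using T\<sigma>[OF z(1)] S(9)[OF q(1)] elim(6) by simp
        then have "f_germ d (of_real t) (H' z) = f_germ d (of_real s) (H (H' z))" by (rule fH)
        also have "H (H' z) = z" using hom TV z(1) by (auto simp: homeomorphism_def)
        also have "f_germ d (of_real s) z = c" using z(1) \<phi>(2) seg by (auto simp: T_def)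
        finally show "f_germ d (of_real t) (x, y) = c" by (simp add: z)
      qed
      moreover have "(x1, y') \<in> H' ` T" "(x2, y') \<in> H' ` T"
      proof -
        have "H q1 \<in> T" "H q2 \<in> T" unfolding Hq T_def by auto
        then show "(x1, y') \<in> H' ` T" "(x2, y') \<in> H' ` T"
          using H'q by (metis imageI q1_def, metis imageI q2_def)
      qed
      moreover have "0 \<notin> ball y' (e powr (3/2) / 2)" using nb by blast
      \<comment> \<open>The disc around \<open>y'\<close> contains no branch point for f_t, so the
        preimage of \<open>T\<close> lies on a single sheet and its two points over
        \<open>y'\<close> coincide.\<close>
      ultimately obtain \<psi> where "\<And>x y. (x, y) \<in> H' ` T \<Longrightarrow> x = \<psi> y"
        using fibre_sheet[of "of_real t" y' "e powr (3/2) / 2" d c "H' ` T"] t(1) nb by (metis of_real_eq_0_iff)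
      then have "x1 = x2"
        using \<open>(x1, y') \<in> H' ` T\<close> \<open>(x2, y') \<in> H' ` T\<close> by metis
      with S(5) show False ..
    qed
    then show ?case
      unfolding c_def y0_def p_def R_def by (auto simp: dist_norm norm_minus_commute)
  qed
qed

section \<open>Comparison of the two polar branches and the uncountable family\<close>

text \<open>The branch x = -t y^d of f_t is the branch x = t' y^d for t' = -t, so the preceding
  result covers both polar branches.\<close>

lemma f_germ_uminus: "f_germ d (- t) = f_germ d t"
  by (simp add: f_germ_def)

text \<open>Applying the preceding result to both polar branches at height e gives \<open>y1\<close>
  and \<open>y2\<close> of size at least about e whose difference is o(e). Their ratio thus tends to
  1, while its n-th power is confined to a finite set independent of e, which therefore contains
  1.\<close>

lemma bi_holder_conjugated_imp_eq:
  fixes s t :: real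
  assumes d: "d \<ge> 2" and t: "0 < t" "t < 1 / 2" and s: "0 < s" "s < 1 / 2"
    and conj: "bi_holder_conjugated (9/10) (f_germ d (of_real t)) (f_germ d (of_real s))"
  shows "t = s"
proof -
  obtain H H' U V c1 c2 where H0: "H 0 = 0" and U: "open U" "0 \<in> U" and V: "open V" "0 \<in> V"
    and hom: "homeomorphism U V H H'"
    and c1: "\<And>a b. \<lbrakk>a \<in> U; b \<in> U\<rbrakk> \<Longrightarrow> norm (H a - H b) \<le> c1 * norm (a - b) powr (9/10)"
    and c2: "\<And>a b. \<lbrakk>a \<in> V; b \<in> V\<rbrakk> \<Longrightarrow> norm (H' a - H' b) \<le> c2 * norm (a - b) powr (9/10)"
    and c: "c1 > 0" "c2 > 0"
    and ev: "\<forall>\<^sub>F z in nhds 0. f_germ d (of_real t) z = f_germ d (of_real s) (H z)"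
    using conj unfolding bi_holder_conjugated_def bi_holder_germ_def bi_holder_def holder_map_def comp_def
    by blast
  define C where "C = max c1 c2"
  have C: "C > 0" "c1 \<le> C" "c2 \<le> C" using c by (auto simp: C_def)
  have HC: "norm (H a - H b) \<le> C * norm (a - b) powr (9/10)" if "a \<in> U" "b \<in> U" for a b
    using c1[OF that] C(2) by (meson mult_right_mono order_trans powr_ge_zero)
  have HC': "norm (H' a - H' b) \<le> C * norm (a - b) powr (9/10)" if "a \<in> V" "b \<in> V" for a b
    using c2[OF that] C(3) by (meson mult_right_mono order_trans powr_ge_zero)
  have "\<forall>\<^sub>F z in nhds 0. z \<in> U \<and> z \<in> V \<and> f_germ d (of_real t) z = f_germ d (of_real s) (H z)"
    using ev U V by (intro eventually_conj eventually_nhds_in_open) auto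
  then obtain r where r: "r > 0" and rb: "\<And>z. z \<in> ball 0 r \<Longrightarrow> z \<in> U \<and> z \<in> V \<and> f_germ d (of_real t) z = f_germ d (of_real s) (H z)"
    unfolding eventually_nhds_metric by (auto simp: dist_commute)
  have rU: "ball 0 r \<subseteq> U" and rV: "ball 0 r \<subseteq> V" using rb by blast+
  define n where "n = 3 * d"
  have n: "n > 0" using d by (simp add: n_def)
  define a b where "a = 2 * t ^ 3" and "b = 2 * s ^ 3"
  have "t ^ 3 < (1 / 2) ^ 3" "s ^ 3 < (1 / 2) ^ 3" using t s by (auto intro!: power_strict_mono)
  then have ab: "0 < a" "a < 1 / 4" "0 < b" "b < 1 / 4" using t s by (auto simp: a_def b_def power_divide)
  \<comment> \<open>The possible values of (y2/y1)^n, namely (1 + a) w1 / ((1 - a) w2) with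
    \<open>w1\<close> and \<open>w2\<close> each 1 - b or 1 + b.\<close>
  define F where "F = complex_of_real ` {(1 + a) / (1 - a), (1 + a) * (1 - b) / ((1 - a) * (1 + b)), (1 + a) * (1 + b) / ((1 - a) * (1 - b))}"
  have "1 \<in> F"
  proof (rule ccontr)
    assume "1 \<notin> F"
    \<comment> \<open>Since \<open>F\<close> is finite, u^n avoids it for all u close to 1; the
      contradiction comes from u = y2/y1.\<close>
    have "((\<lambda>u::complex. u ^ n) \<longlongrightarrow> 1 ^ n) (nhds 1)"
      by (intro tendsto_power filterlim_ident)
    moreover have "open (- F)" by (intro open_Compl finite_imp_closed) (simp add: F_def)
    ultimately have "\<forall>\<^sub>F u in nhds 1. u ^ n \<in> - F"
      by (rule topological_tendstoD) (use \<open>1 \<notin> F\<close> in simp)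
    then obtain \<eta> where \<eta>: "\<eta> > 0" "\<And>u. dist u 1 < \<eta> \<Longrightarrow> u ^ n \<notin> F"
      unfolding eventually_nhds_metric by auto
    define R where "R = (\<lambda>e. 2 * C * (4 * e powr (3/2)) powr (9/10))"
    have "\<forall>\<^sub>F e in at_right 0. 2 * R e + C * (e\<^sup>2) powr (9/10) < \<eta> * (e / 2)"
      unfolding R_def using C(1) \<eta>(1) by real_asymp
    moreover have "\<forall>\<^sub>F e in at_right 0. 4 * e < r" "\<forall>\<^sub>F e in at_right (0::real). e < 1" "\<forall>\<^sub>F e in at_right (0::real). e > 0"
      using r by real_asymp+
    moreover have "\<forall>\<^sub>F e in at_right 0. \<exists>y. norm (y - snd (H (of_real e ^ d * of_real t, of_real e))) < R e \<and>
      (y ^ (3 * d) * (1 - 2 * of_real s ^ 3) = of_real e ^ (3 * d) * (1 - 2 * of_real t ^ 3) \<or>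
       y ^ (3 * d) * (1 + 2 * of_real s ^ 3) = of_real e ^ (3 * d) * (1 - 2 * of_real t ^ 3))"
      unfolding R_def using t s rb
      by (intro branch_point_near_image[OF d _ _ _ _ C(1) r rU rV hom H0 HC HC']) auto
    moreover have "\<forall>\<^sub>F e in at_right 0. \<exists>y. norm (y - snd (H (of_real e ^ d * of_real (- t), of_real e))) < R e \<and>
      (y ^ (3 * d) * (1 - 2 * of_real s ^ 3) = of_real e ^ (3 * d) * (1 - 2 * of_real (- t) ^ 3) \<or>
       y ^ (3 * d) * (1 + 2 * of_real s ^ 3) = of_real e ^ (3 * d) * (1 - 2 * of_real (- t) ^ 3))"
      unfolding R_def using t s rb
      by (intro branch_point_near_image[OF d _ _ _ _ C(1) r rU rV hom H0 HC HC']) (auto simp: f_germ_uminus)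
    ultimately have "\<forall>\<^sub>F e in at_right (0::real). False"
    proof eventually_elim
      case (elim e)
      define p1 p2 where "p1 = (complex_of_real e ^ d * of_real t, complex_of_real e)"
        and "p2 = (complex_of_real e ^ d * of_real (- t), complex_of_real e)"
      obtain y1 where y1: "norm (y1 - snd (H p1)) < R e"
        "y1 ^ n * of_real (1 - b) = of_real (e ^ n * (1 - a)) \<or> y1 ^ n * of_real (1 + b) = of_real (e ^ n * (1 - a))"
        using elim(5) by (auto simp: p1_def n_def a_def b_def)
      obtain y2 where y2: "norm (y2 - snd (H p2)) < R e"
        "y2 ^ n * of_real (1 - b) = of_real (e ^ n * (1 + a)) \<or> y2 ^ n * of_real (1 + b) = of_real (e ^ n * (1 + a))"
        using elim(6) by (auto simp: p2_def n_def a_def b_def)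
      have e: "0 < e" "e < 1" "e ^ d \<le> e\<^sup>2" "e\<^sup>2 \<le> e"
        using elim(3,4) d power_decreasing[of 2 d e] power_decreasing[of 1 2 e] by simp_all
      have pr: "p \<in> U" if "p = p1 \<or> p = p2" for p
      proof -
        have "norm p \<le> e ^ d * t + e"
          using that t e norm_Pair_le[of "complex_of_real e ^ d * of_real t" "complex_of_real e"]
            norm_Pair_le[of "complex_of_real e ^ d * of_real (- t)" "complex_of_real e"]
          by (auto simp: p1_def p2_def norm_mult norm_power)
        also have "\<dots> \<le> e\<^sup>2 * 1 + e" using e t by (intro add_mono mult_mono) auto
        also have "\<dots> < r" using e elim(2) by simp
        finally show ?thesis using rU by auto
      qed
      have "norm (p1 - p2) \<le> e\<^sup>2"
      proof -
        have "norm (p1 - p2) = e ^ d * (2 * t)"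
        proof -
          have "p1 - p2 = (of_real (e ^ d * (2 * t)), 0)" by (simp add: p1_def p2_def)
          then show ?thesis using e t by (simp add: norm_Pair norm_mult norm_power)
        qed
        also have "\<dots> \<le> e\<^sup>2 * 1" using e t by (intro mult_mono) auto
        finally show ?thesis by simp
      qed
      then have "C * norm (p1 - p2) powr (9/10) \<le> C * (e\<^sup>2) powr (9/10)"
        using C(1) by (intro mult_left_mono powr_mono2) auto
      then have "norm (H p1 - H p2) \<le> C * (e\<^sup>2) powr (9/10)"
        using HC[OF pr pr, of p1 p2] by simp
      moreover have "norm (snd (H p1) - snd (H p2)) \<le> norm (H p1 - H p2)"
        by (metis dist_norm dist_snd_le)
      moreover have "norm (y2 - y1) \<le> norm (y2 - snd (H p2)) + norm (snd (H p1) - snd (H p2)) + norm (y1 - snd (H p1))"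
        by norm
      ultimately have y12: "norm (y2 - y1) < \<eta> * (e / 2)" using y1(1) y2(1) elim(1) by linarith
      have divc: "z = of_real (v / w)" if "z * of_real w = of_real v" "w > 0" for z :: complex and v w :: real
        using that by (simp add: field_simps)
      have b: "1 - b > 0" "1 + b > 0" using ab by auto
      obtain w1 where w1: "w1 \<in> {1 - b, 1 + b}" "y1 ^ n = of_real (e ^ n * (1 - a) / w1)"
        using y1(2) divc[OF _ b(1)] divc[OF _ b(2)] by blast
      obtain w2 where w2: "w2 \<in> {1 - b, 1 + b}" "y2 ^ n = of_real (e ^ n * (1 + a) / w2)"
        using y2(2) divc[OF _ b(1)] divc[OF _ b(2)] by blast
      \<comment> \<open>As a and b are below 1/4, the factor (1 - a)/w1 exceeds 1/2, which is at
        least (1/2)^n.\<close>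
      have y1e: "e / 2 \<le> norm y1"
      proof -
        have "1 / 2 \<le> (1 - a) / w1" using w1(1) ab by (auto simp: le_divide_eq)
        then have "e ^ n * (1 / 2) \<le> e ^ n * ((1 - a) / w1)" using e by (intro mult_left_mono) auto
        also have "\<dots> \<le> norm y1 ^ n"
          using abs_ge_self[of "e ^ n * (1 - a) / w1"] by (metis norm_of_real norm_power times_divide_eq_right w1(2))
        finally have "e ^ n * (1 / 2) \<le> norm y1 ^ n" .
        moreover have "(1 / 2 :: real) ^ n \<le> 1 / 2"
          using n power_decreasing[of 1 n "1 / 2 :: real"] by simp
        then have "(e / 2) ^ n \<le> e ^ n * (1 / 2)"
          using e by (simp add: power_divide field_simps)
        ultimately have "(e / 2) ^ n \<le> norm y1 ^ n" by linarith
        then show ?thesis using n e by (simp add: power_mono_iff)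
      qed
      then have y10: "y1 \<noteq> 0" using e by auto
      define u where "u = y2 / y1"
      have "dist u 1 = norm (y2 - y1) / norm y1"
        using y10 by (simp add: u_def dist_norm field_simps flip: norm_divide)
      also have "\<dots> < \<eta>"
      proof -
        have "\<eta> * (e / 2) \<le> \<eta> * norm y1" using y1e \<eta>(1) by (intro mult_left_mono) auto
        with y12 have "norm (y2 - y1) < \<eta> * norm y1" by linarith
        then show ?thesis using y10 by (simp add: divide_less_eq)
      qed
      finally have "u ^ n \<notin> F" by (rule \<eta>(2))
      moreover have "u ^ n \<in> F"
      proof -
        have "(1 + a) * w1 / ((1 - a) * w2) \<in> {(1 + a) / (1 - a),
            (1 + a) * (1 - b) / ((1 - a) * (1 + b)), (1 + a) * (1 + b) / ((1 - a) * (1 - b))}"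
          using w1(1) w2(1) ab by auto
        moreover have "(1 + a) * w1 / ((1 - a) * w2) = (e ^ n * (1 + a) / w2) / (e ^ n * (1 - a) / w1)"
          using e by simp
        then have "u ^ n = of_real ((1 + a) * w1 / ((1 - a) * w2))"
          by (simp only: u_def power_divide w1(2) w2(2) of_real_divide)
        ultimately show ?thesis unfolding F_def by (metis imageI)
      qed
      ultimately show False ..
    qed
    then show False by simp
  qed
  then have "1 \<in> {(1 + a) / (1 - a), (1 + a) * (1 - b) / ((1 - a) * (1 + b)), (1 + a) * (1 + b) / ((1 - a) * (1 - b))}"
    unfolding F_def by (metis (no_types, lifting) imageE of_real_eq_1_iff)
  \<comment> \<open>Positivity of a and b excludes the first and third candidates; the remaining one
    equals 1 only if a = b.\<close>
  moreover have "(1 + a) / (1 - a) > 1" using ab by (simp add: less_divide_eq)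
  moreover have "(1 + a) * (1 + b) / ((1 - a) * (1 - b)) > 1"
    using ab by (simp add: less_divide_eq mult_strict_mono)
  ultimately have "(1 + a) * (1 - b) / ((1 - a) * (1 + b)) = 1"
    by (metis insert_iff empty_iff less_irrefl)
  then have "(1 + a) * (1 - b) = (1 - a) * (1 + b)" using ab by (simp add: divide_eq_eq_1)
  then have "a = b" by (simp add: algebra_simps)
  then show ?thesis using t s by (simp add: a_def b_def power_eq_iff_eq_base)
qed

theorem mainTheorem2:
  fixes d :: nat
  assumes "d > 1"
  shows "\<exists>I :: complex set. uncountable I \<and>
           (\<forall>s\<in>I. \<forall>t\<in>I. t \<noteq> s \<longrightarrow> \<not> holder_equivalent (f_germ d t) (f_germ d s))"
\<comment> \<open>Since f_t depends only on t^2, the parameters are taken positive, so that no pair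
  t, -t occurs. Hoelder equivalence asks for every exponent below 1, hence failure at 9/10 refutes
  it.\<close>
proof (intro exI[of _ "complex_of_real ` {0<..<1 / 2}"] conjI ballI impI)
  have "uncountable {0<..<1 / 2 :: real}"
    by (simp add: uncountable_open_interval)
  then show "uncountable (complex_of_real ` {0<..<1 / 2})"
    by (auto dest!: countable_image_inj_on intro: inj_onI)
next
  fix s t
  assume "s \<in> complex_of_real ` {0<..<1 / 2}" "t \<in> complex_of_real ` {0<..<1 / 2}" "t \<noteq> s"
  then obtain s' t' where st: "s = of_real s'" "t = of_real t'" "0 < s'" "s' < 1 / 2" "0 < t'" "t' < 1 / 2" "t' \<noteq> s'"
    by auto
  then have "\<not> bi_holder_conjugated (9/10) (f_germ d t) (f_germ d s)"
    using bi_holder_conjugated_imp_eq[of d t' s'] assms by auto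
  then show "\<not> holder_equivalent (f_germ d t) (f_germ d s)"
    unfolding holder_equivalent_def by (auto intro!: exI[of _ "9/10 :: real"])
qed

end
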